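(* Let $m>-1$ and $x>0$ be fixed real numbers, and regard $V_m^p(x)$ as a function of $p\in(0,\infty)$. Then: (i) $\lim_{p\to 0^+}V_m^p(x)=\infty$. (ii) If $x\ge 1$, then $V_m^p(x)$ is decreasing in $p$. Moreover, if $x>1$, then $\lim_{p\to\infty}V_m^p(x)=0$, and if $x=1$, then $\lim_{p\to\infty}V_m^p(1)=\frac{1}{\Gamma(m+1)}\int_0^\infty\frac{u^m e^{-u}}{1+u}\,du$. (iii) If $0<x<1$ and $m>0$, then $\lim_{p\to\infty}V_m^p(x)=\frac1m$.
   Context: For real $p>0$, real $m>-1$ and $x>0$, $V_m^p(x)=\frac{p e^{x^p}}{\Gamma(m+1)}\int_x^\infty (t^p-x^p)^m e^{-t^p}\,dt=\frac{1}{\Gamma(m+1)}\int_0^\infty \frac{u^m e^{-u}}{(x^p+u)^{(p-1)/p}}\,du$. *)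

theory Defs
  imports "HOL-Analysis.Analysis"
begin

(* Intended for m > -1, p > 0, x > 0. The endpoint t = x is left out, as the integrand is
   singular there for m < 0; this does not affect the value. *)
definition V :: "real \<Rightarrow> real \<Rightarrow> real \<Rightarrow> real" where
  "V m p x = p * exp (x powr p) / Gamma (m + 1) *
     (LBINT t:{x<..}. (t powr p - x powr p) powr m * exp (- (t powr p)))"

end

theory Submission
  imports Defs "HOL-Real_Asymp.Real_Asymp"
begin

text \<open>
  The substitution \<open>t = (x\<^sup>p + u)\<^bsup>1/p\<^esup>\<close> turns \<open>V m p x\<close> into the average of the kernel
  \<open>(x\<^sup>p + u)\<^bsup>1/p - 1\<^esup>\<close> against the Gamma weight \<open>u\<^sup>m e\<^bsup>-u\<^esup>\<close>, which does not depend on \<open>p\<close>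
  (lemma \<open>V_eq\<close>). All claims then come from the behaviour of the kernel at a fixed \<open>u > 0\<close>.

  As \<open>p\<close> tends to 0, the base tends to \<open>1 + u > 1\<close> and the exponent to infinity, so the kernel
  blows up, uniformly for \<open>u > 1\<close>; this part of the range already forces divergence.

  For \<open>x \<ge> 1\<close> write the kernel as \<open>x (1 + u x\<^bsup>-p\<^esup>)\<^bsup>1/p\<^esup> / (x\<^sup>p + u)\<close>. In the numerator both the
  base, which exceeds 1, and the exponent go down as \<open>p\<close> grows, while the denominator does not
  go down. Strict monotonicity for each \<open>u\<close> survives integration.

  As \<open>p\<close> tends to infinity, the exponent tends to \<open>-1\<close> and \<open>x\<^sup>p\<close> to \<open>\<infinity>\<close>, 1 or 0, so the kernel
  tends to 0, \<open>1 / (1 + u)\<close> or \<open>1 / u\<close>. For \<open>p \<ge> 1\<close> it is at most 1 when \<open>x \<ge> 1\<close>, and at most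
  \<open>(1 + u) / u\<close> when \<open>x < 1\<close>; dominated convergence applies. The factor \<open>1 / u\<close> lowers the
  exponent of the weight to \<open>m - 1\<close>, which is integrable at 0 only for \<open>m > 0\<close>, and the limit is
  \<open>\<Gamma>(m) / \<Gamma>(m + 1) = 1 / m\<close>.
\<close>

section \<open>Strict positivity of integrals and the Gamma weight\<close>

text \<open>
  A nonnegative function whose integral is zero vanishes almost everywhere, which positivity on a
  set of nonzero measure excludes.
\<close>

lemma set_integral_pos:
  fixes f :: "'a \<Rightarrow> real"
  assumes int: "set_integrable M A f" and A: "A \<in> sets M" "emeasure M A \<noteq> 0"
    and pos: "\<And>x. x \<in> A \<Longrightarrow> 0 < f x"
  shows "0 < (LINT x:A|M. f x)"
proof -
  let ?g = "\<lambda>x. indicator A x *\<^sub>R f x"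
  have g: "integrable M ?g"
    using int by (simp add: set_integrable_def)
  have nonneg: "0 \<le> ?g x" for x
    using pos[of x] by (auto simp: indicator_def)
  have "integral\<^sup>L M ?g \<noteq> 0"
  proof
    assume "integral\<^sup>L M ?g = 0"
    then have "AE x in M. ?g x = 0"
      using integral_nonneg_eq_0_iff_AE[OF g] nonneg by simp
    then have "AE x in M. x \<notin> A"
      by eventually_elim (use pos in \<open>force simp: indicator_def split: if_splits\<close>)
    then show False
      using A AE_iff_measurable[OF A(1), of "\<lambda>x. x \<notin> A"] sets.sets_into_space[OF A(1)] by auto
  qed
  moreover have "0 \<le> integral\<^sup>L M ?g"
    using nonneg by (intro integral_nonneg_AE) auto
  ultimately show ?thesis
    by (simp add: set_lebesgue_integral_def)
qed

lemma has_bochner_integral_Gamma: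
  fixes m :: real
  assumes "m > -1"
  shows "has_bochner_integral lborel (\<lambda>u. indicator {0<..} u *\<^sub>R (u powr m * exp (- u))) (Gamma (m + 1))"
proof (rule has_bochner_integral_nn_integral)
  have "(\<integral>\<^sup>+u. ennreal (indicator {0<..} u *\<^sub>R (u powr m * exp (- u))) \<partial>lborel)
      = (\<integral>\<^sup>+u. ennreal (indicator {0..} u * u powr (m + 1 - 1) / exp u) \<partial>lborel)"
    by (intro nn_integral_cong) (auto simp: indicator_def exp_minus divide_inverse)
  then show "(\<integral>\<^sup>+u. ennreal (indicator {0<..} u *\<^sub>R (u powr m * exp (- u))) \<partial>lborel)
      = ennreal (Gamma (m + 1))"
    using Gamma_conv_nn_integral_real[of "m + 1"] assms by simp
  show "0 \<le> Gamma (m + 1)"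
    using Gamma_real_pos[of "m + 1"] assms by simp
qed auto

lemma set_integrable_Gamma:
  "m > -1 \<Longrightarrow> set_integrable lborel {0<..} (\<lambda>u::real. u powr m * exp (- u))"
  using has_bochner_integral_Gamma[of m] by (auto simp: set_integrable_def has_bochner_integral_iff)

lemma set_integral_Gamma:
  "m > -1 \<Longrightarrow> (LBINT u:{0<..}. u powr m * exp (- u)) = Gamma (m + 1)" for m :: real
  using has_bochner_integral_Gamma[of m]
  by (auto simp: set_lebesgue_integral_def has_bochner_integral_iff)

text \<open>
  A positive power of \<open>c + u\<close> grows at most like the same power of \<open>u\<close>, which only raises the
  exponent of the weight; a negative one is bounded by its value at \<open>u = 0\<close>. Small \<open>p\<close> makes
  the exponent \<open>1 / p - 1\<close> arbitrarily large, so both signs occur.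
\<close>

lemma set_integrable_Gamma_shifted_powr:
  fixes m c a :: real
  assumes m: "m > -1" and c: "c > 0"
  shows "set_integrable lborel {0<..} (\<lambda>u. u powr m * exp (- u) * (c + u) powr a)"
proof -
  define b where "b = max a 0"
  define C where "C = max (c powr a) ((2 * c) powr b)"
  have bound: "(c + u) powr a \<le> C + 2 powr b * u powr b" if u: "u > 0" for u
  proof (cases "a \<ge> 0")
    case True
    then have [simp]: "b = a" by (simp add: b_def)
    show ?thesis
    proof (cases "u \<le> c")
      case True
      then have "(c + u) powr a \<le> (2 * c) powr a"
        using u c \<open>a \<ge> 0\<close> by (intro powr_mono2) auto
      moreover have "0 \<le> 2 powr b * u powr b" by simp
      moreover have "(2 * c) powr b \<le> C" by (simp add: C_def)
      ultimately show ?thesis unfolding \<open>b = a\<close> by linarith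
    next
      case False
      then have "(c + u) powr a \<le> (2 * u) powr a"
        using u c \<open>a \<ge> 0\<close> by (intro powr_mono2) auto
      moreover have "0 \<le> C" by (simp add: C_def le_max_iff_disj)
      ultimately show ?thesis using u by (simp add: powr_mult)
    qed
  next
    case False
    then have "(c + u) powr a \<le> c powr a"
      using u c by (intro powr_mono2') auto
    moreover have "0 \<le> 2 powr b * u powr b" by simp
    moreover have "c powr a \<le> C" by (simp add: C_def)
    ultimately show ?thesis by linarith
  qed
  have "m + b > -1"
    using m by (simp add: b_def)
  then have "set_integrable lborel {0<..}
      (\<lambda>u. C * (u powr m * exp (- u)) + 2 powr b * (u powr (m + b) * exp (- u)))"
    by (intro set_integral_add set_integrable_mult_right set_integrable_Gamma m)
  then show ?thesis
  proof (rule set_integrable_bound)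
    show "set_borel_measurable lborel {0<..} (\<lambda>u. u powr m * exp (- u) * (c + u) powr a)"
      unfolding set_borel_measurable_def by measurable
    show "AE u in lborel. u \<in> {0<..} \<longrightarrow> norm (u powr m * exp (- u) * (c + u) powr a)
      \<le> norm (C * (u powr m * exp (- u)) + 2 powr b * (u powr (m + b) * exp (- u)))"
    proof (intro AE_I2 impI)
      fix u :: real assume "u \<in> {0<..}"
      then have u: "u > 0" by simp
      have "u powr m * exp (- u) * (c + u) powr a
          \<le> u powr m * exp (- u) * (C + 2 powr b * u powr b)"
        using bound[OF u] by (intro mult_left_mono) auto
      also have "\<dots> = C * (u powr m * exp (- u)) + 2 powr b * (u powr (m + b) * exp (- u))"
        by (simp add: algebra_simps powr_add)
      finally show "norm (u powr m * exp (- u) * (c + u) powr a)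
          \<le> norm (C * (u powr m * exp (- u)) + 2 powr b * (u powr (m + b) * exp (- u)))"
        using u by simp
    qed
  qed
qed

section \<open>The function as a weighted average of a kernel\<close>

text \<open>
  The substitution is carried out from \<open>u\<close> to \<open>t\<close>, so that the integrability to be supplied is
  that of the Gamma weight times the kernel, known from the previous lemma; integrability in \<open>t\<close>
  is then a consequence.
\<close>

lemma V_eq:
  fixes m p x :: real
  assumes m: "m > -1" and p: "p > 0" and x: "x > 0"
  shows "V m p x = 1 / Gamma (m + 1) *
    (LBINT u:{0<..}. u powr m * exp (- u) * (x powr p + u) powr (1 / p - 1))"
proof -
  define c where "c = x powr p"
  have c: "c > 0" using x by (simp add: c_def)
  define g where "g = (\<lambda>u::real. (c + u) powr (1 / p))"
  define g' where "g' = (\<lambda>u::real. 1 / p * (c + u) powr (1 / p - 1))"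
  define f where "f = (\<lambda>t::real. (t powr p - c) powr m * exp (- (t powr p)))"
  define k where "k = (\<lambda>u::real. u powr m * exp (- u) * (c + u) powr (1 / p - 1))"
  have g_powr: "g u powr p = c + u" if "u \<ge> 0" for u
    using p that c by (simp add: g_def powr_powr)
  have fg: "f (g u) * g' u = exp (- c) / p * k u" if "u > 0" for u
    using that by (simp add: f_def g_powr g'_def k_def exp_minus exp_add divide_simps)
  have k_int: "set_integrable lborel {0<..} k"
    unfolding k_def by (rule set_integrable_Gamma_shifted_powr[OF m c])
  have "(LBINT t=ereal x..\<infinity>. f t) = (LBINT u=ereal 0..\<infinity>. f (g u) * g' u)"
  proof (rule interval_integral_substitution_nonneg(2))
    fix u assume "ereal 0 < ereal u" "ereal u < \<infinity>"
    then have u: "u > 0" by simp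
    show "DERIV g u :> g' u"
      unfolding g_def g'_def using u c p
      by (auto intro!: derivative_eq_intros simp: powr_diff field_simps)
    have "g u > 0" "g u powr p - c > 0"
      using u c by (auto simp: g_powr) (simp add: g_def)
    then show "isCont f (g u)"
      unfolding f_def by (intro continuous_intros) auto
    show "isCont g' u"
      unfolding g'_def using u c p by (intro continuous_intros) auto
    show "0 \<le> f (g u)" by (simp add: f_def)
  next
    fix u show "0 \<le> g' u" using p by (simp add: g'_def)
  next
    have "(g \<longlongrightarrow> g 0) (at_right 0)"
      unfolding g_def using c by (auto intro!: tendsto_eq_intros)
    moreover have "g 0 = x" using x p by (simp add: g_def c_def powr_powr)
    ultimately show "((ereal \<circ> g \<circ> real_of_ereal) \<longlongrightarrow> ereal x) (at_right (ereal 0))"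
      by (simp add: ereal_tendsto_simps)
  next
    have "filterlim g at_top at_top"
      unfolding g_def using p by real_asymp
    then show "((ereal \<circ> g \<circ> real_of_ereal) \<longlongrightarrow> \<infinity>) (at_left \<infinity>)"
      by (simp add: ereal_tendsto_simps)
  next
    have "set_integrable lborel {0<..} (\<lambda>u. exp (- c) / p * k u)"
      by (intro set_integrable_mult_right k_int)
    then show "set_integrable lborel (einterval (ereal 0) \<infinity>) (\<lambda>u. f (g u) * g' u)"
      using fg by (subst set_integrable_cong[where f' = "\<lambda>u. exp (- c) / p * k u"]) auto
  qed auto
  then have "(LBINT t:{x<..}. f t) = (LBINT u:{0<..}. f (g u) * g' u)"
    unfolding interval_integral_to_infinity_eq .
  also have "\<dots> = (LBINT u:{0<..}. exp (- c) / p * k u)"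
    by (rule set_lebesgue_integral_cong) (auto simp: fg)
  also have "\<dots> = exp (- c) / p * (LBINT u:{0<..}. k u)"
    by simp
  finally have "V m p x = p * exp c / Gamma (m + 1) * (exp (- c) / p * (LBINT u:{0<..}. k u))"
    by (simp add: V_def f_def c_def)
  then show ?thesis
    using p by (simp add: k_def c_def exp_minus)
qed

section \<open>Behaviour at infinity, at zero, and monotonicity\<close>

text \<open>
  Dominated convergence in the form common to the three limits at infinity: a limit \<open>h\<close> and a
  majorant \<open>w\<close> of the kernel alone, the weight being the same throughout.
\<close>

lemma V_tendsto_at_top_dominated:
  fixes m x :: real and h w :: "real \<Rightarrow> real"
  assumes m: "m > -1" and x: "x > 0"
    and lim: "\<And>u. u > 0 \<Longrightarrow> ((\<lambda>p. (x powr p + u) powr (1 / p - 1)) \<longlongrightarrow> h u) at_top"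
    and bound: "\<And>u p. u > 0 \<Longrightarrow> p \<ge> 1 \<Longrightarrow> (x powr p + u) powr (1 / p - 1) \<le> w u"
    and w: "set_integrable lborel {0<..} (\<lambda>u. u powr m * exp (- u) * w u)"
    and [measurable]: "h \<in> borel_measurable borel"
  shows "((\<lambda>p. V m p x) \<longlongrightarrow> 1 / Gamma (m + 1) * (LBINT u:{0<..}. u powr m * exp (- u) * h u)) at_top"
proof -
  have "((\<lambda>p. LBINT u:{0<..}. u powr m * exp (- u) * (x powr p + u) powr (1 / p - 1))
      \<longlongrightarrow> (LBINT u:{0<..}. u powr m * exp (- u) * h u)) at_top"
    unfolding set_lebesgue_integral_def
  proof (rule integral_dominated_convergence_at_top)
    show "integrable lborel (\<lambda>u. indicator {0<..} u *\<^sub>R (u powr m * exp (- u) * w u))"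
      using w by (simp add: set_integrable_def)
    show "\<forall>\<^sub>F p in at_top. AE u in lborel.
        norm (indicator {0<..} u *\<^sub>R (u powr m * exp (- u) * (x powr p + u) powr (1 / p - 1)))
        \<le> indicator {0<..} u *\<^sub>R (u powr m * exp (- u) * w u)"
      using eventually_ge_at_top[of 1]
      by eventually_elim (auto simp: indicator_def intro!: AE_I2 mult_left_mono bound)
    show "AE u in lborel. ((\<lambda>p. indicator {0<..} u *\<^sub>R
          (u powr m * exp (- u) * (x powr p + u) powr (1 / p - 1)))
        \<longlongrightarrow> indicator {0<..} u *\<^sub>R (u powr m * exp (- u) * h u)) at_top"
      by (intro AE_I2) (auto simp: indicator_def intro!: tendsto_mult lim)
  qed measurable
  then have "((\<lambda>p. 1 / Gamma (m + 1) *
      (LBINT u:{0<..}. u powr m * exp (- u) * (x powr p + u) powr (1 / p - 1)))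
      \<longlongrightarrow> 1 / Gamma (m + 1) * (LBINT u:{0<..}. u powr m * exp (- u) * h u)) at_top"
    by (intro tendsto_intros)
  then show ?thesis
    by (rule Lim_transform_eventually)
      (use eventually_gt_at_top[of 0] in eventually_elim, simp add: V_eq m x)
qed

text \<open>
  Once \<open>x\<^sup>p > 1 / 2\<close>, the base of the kernel exceeds \<open>3 / 2\<close> for all \<open>u > 1\<close>. Hence \<open>V\<close> is at least
  a positive constant times \<open>(3 / 2)\<^bsup>1/p - 1\<^esup>\<close>.
\<close>

lemma V_at_right_0:
  fixes m x :: real
  assumes m: "m > -1" and x: "x > 0"
  shows "filterlim (\<lambda>p. V m p x) at_top (at_right 0)"
proof -
  define I where "I = (LBINT u:{1<..}. u powr m * exp (- u))"
  have w_int: "set_integrable lborel {1<..} (\<lambda>u::real. u powr m * exp (- u))"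
    by (rule set_integrable_subset[OF set_integrable_Gamma[OF m]]) auto
  have G: "Gamma (m + 1) > 0" using m by (intro Gamma_real_pos) simp
  have "{1<..<2::real} \<subseteq> {1<..}" by auto
  then have "emeasure lborel {1<..<2::real} \<le> emeasure lborel {1::real<..}"
    by (intro emeasure_mono) auto
  then have I: "I > 0"
    unfolding I_def by (intro set_integral_pos w_int) auto
  have lower: "(3 / 2) powr (1 / p - 1) * I / Gamma (m + 1) \<le> V m p x"
    if p: "0 < p" "p < 1" and xp: "x powr p > 1 / 2" for p
  proof -
    have c: "x powr p > 0" using x by simp
    note int = set_integrable_Gamma_shifted_powr[OF m c, of "1 / p - 1"]
    have "(3 / 2) powr (1 / p - 1) * I
        = (LBINT u:{1<..}. (3 / 2) powr (1 / p - 1) * (u powr m * exp (- u)))"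
      by (simp add: I_def)
    also have "\<dots> \<le> (LBINT u:{1<..}. u powr m * exp (- u) * (x powr p + u) powr (1 / p - 1))"
    proof (rule set_integral_mono)
      show "set_integrable lborel {1<..} (\<lambda>u. (3 / 2) powr (1 / p - 1) * (u powr m * exp (- u)))"
        by (intro set_integrable_mult_right w_int)
      show "set_integrable lborel {1<..} (\<lambda>u. u powr m * exp (- u) * (x powr p + u) powr (1 / p - 1))"
        by (rule set_integrable_subset[OF int]) auto
      fix u :: real assume "u \<in> {1<..}"
      then have "(3 / 2) powr (1 / p - 1) \<le> (x powr p + u) powr (1 / p - 1)"
        using p xp by (intro powr_mono2) auto
      then show "(3 / 2) powr (1 / p - 1) * (u powr m * exp (- u))
          \<le> u powr m * exp (- u) * (x powr p + u) powr (1 / p - 1)"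
        by (subst mult.commute) (intro mult_left_mono, auto)
    qed
    also have "\<dots> \<le> (LBINT u:{0<..}. u powr m * exp (- u) * (x powr p + u) powr (1 / p - 1))"
      unfolding set_lebesgue_integral_def
    proof (rule integral_mono)
      show "integrable lborel (\<lambda>u. indicator {1<..} u *\<^sub>R
          (u powr m * exp (- u) * (x powr p + u) powr (1 / p - 1)))"
        using set_integrable_subset[OF int, of "{1<..}"] by (auto simp: set_integrable_def)
    qed (use int in \<open>auto simp: set_integrable_def indicator_def\<close>)
    finally show ?thesis
      using G by (simp add: V_eq m p x divide_right_mono)
  qed
  have "((\<lambda>p. x powr p) \<longlongrightarrow> 1) (at_right 0)"
    using x by (auto intro!: tendsto_eq_intros)
  then have "\<forall>\<^sub>F p in at_right 0. x powr p > 1 / 2"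
    by (rule order_tendstoD) simp
  moreover have "\<forall>\<^sub>F p in at_right 0. 0 < p \<and> p < (1::real)"
    by (auto simp: eventually_at_right_field intro: exI[of _ 1])
  ultimately have "\<forall>\<^sub>F p in at_right 0. (3 / 2) powr (1 / p - 1) * I / Gamma (m + 1) \<le> V m p x"
    by eventually_elim (use lower in auto)
  moreover have "filterlim (\<lambda>p. (3 / 2) powr (1 / p - 1) * I / Gamma (m + 1)) at_top (at_right 0)"
    using I G by real_asymp
  ultimately show ?thesis
    by (rule filterlim_at_top_mono[rotated])
qed

text \<open>
  Neither factor of \<open>(x\<^sup>p + u)\<^bsup>1/p\<^esup> \<cdot> (x\<^sup>p + u)\<^bsup>-1\<^esup>\<close> needs differentiation: after pulling \<open>x\<close> out of
  the root, the first is \<open>x\<close> times a power whose exponent and base go down in \<open>p\<close>, the base staying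
  above 1; the second goes down weakly because \<open>x \<ge> 1\<close>.
\<close>

lemma shifted_powr_strict_antimono:
  fixes x u p q :: real
  assumes x: "x \<ge> 1" and u: "u > 0" and pq: "0 < p" "p < q"
  shows "(x powr q + u) powr (1 / q - 1) < (x powr p + u) powr (1 / p - 1)"
proof -
  have root: "(x powr r + u) powr (1 / r) = x * (1 + u / x powr r) powr (1 / r)" if "r > 0" for r
  proof -
    have "x powr r + u = x powr r * (1 + u / x powr r)"
      using x by (simp add: field_simps)
    then show ?thesis
      using x u that by (simp add: powr_mult powr_powr)
  qed
  have le: "x powr p \<le> x powr q"
    using x pq by (intro powr_mono) auto
  have pos: "x powr p > 0" "x powr q > 0" using x by auto
  have "(1 + u / x powr q) powr (1 / q) < (1 + u / x powr q) powr (1 / p)"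
    using u pos pq by (intro powr_less_mono) (auto simp: frac_less2)
  also have "\<dots> \<le> (1 + u / x powr p) powr (1 / p)"
    using u pos pq le by (intro powr_mono2) (auto simp: divide_left_mono)
  finally have num: "(x powr q + u) powr (1 / q) < (x powr p + u) powr (1 / p)"
    using x pq by (simp add: root)
  have "(x powr q + u) powr (1 / q - 1) = (x powr q + u) powr (1 / q) / (x powr q + u)"
    using pos u by (simp add: powr_diff)
  also have "\<dots> < (x powr p + u) powr (1 / p) / (x powr p + u)"
    using num le pos u by (intro frac_less) (auto intro: add_pos_pos)
  also have "\<dots> = (x powr p + u) powr (1 / p - 1)"
    using pos u by (simp add: powr_diff)
  finally show ?thesis .
qed

lemma V_strict_antimono:
  fixes m x :: real
  assumes m: "m > -1" and x: "x \<ge> 1"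
  shows "strict_antimono_on {0<..} (\<lambda>p. V m p x)"
proof (rule monotone_onI)
  fix p q :: real assume "p \<in> {0<..}" and "q \<in> {0<..}" and less: "p < q"
  then have p: "p > 0" and q: "q > 0" by auto
  let ?k = "\<lambda>p u. u powr m * exp (- u) * (x powr p + u) powr (1 / p - 1)"
  have int: "set_integrable lborel {0<..} (?k r)" for r
    using x by (intro set_integrable_Gamma_shifted_powr m) auto
  have "{0<..<1::real} \<subseteq> {0<..}" by auto
  then have "emeasure lborel {0<..<1::real} \<le> emeasure lborel {0::real<..}"
    by (intro emeasure_mono) auto
  then have "0 < (LBINT u:{0<..}. ?k p u - ?k q u)"
    using shifted_powr_strict_antimono[OF x _ p less]
    by (intro set_integral_pos set_integral_diff int) auto
  also have "\<dots> = (LBINT u:{0<..}. ?k p u) - (LBINT u:{0<..}. ?k q u)"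
    by (intro set_integral_diff int)
  finally show "V m q x < V m p x"
    using x m p q Gamma_real_pos[of "m + 1"] by (simp add: V_eq divide_strict_right_mono)
qed

lemma V_at_top_gt_1:
  fixes m x :: real
  assumes m: "m > -1" and x: "x > 1"
  shows "((\<lambda>p. V m p x) \<longlongrightarrow> 0) at_top"
proof -
  have "((\<lambda>p. V m p x) \<longlongrightarrow> 1 / Gamma (m + 1) * (LBINT u:{0<..}. u powr m * exp (- u) * 0)) at_top"
  proof (rule V_tendsto_at_top_dominated[OF m])
    fix u :: real assume u: "u > 0"
    show "((\<lambda>p. (x powr p + u) powr (1 / p - 1)) \<longlongrightarrow> 0) at_top"
      using x u by real_asymp
    fix p :: real assume p: "p \<ge> 1"
    have "1 \<le> x powr p" using x p by (intro ge_one_powr_ge_zero) auto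
    then have "(x powr p + u) powr (1 / p - 1) \<le> 1 powr (1 / p - 1)"
      using u p by (intro powr_mono2') auto
    then show "(x powr p + u) powr (1 / p - 1) \<le> 1" by simp
  qed (use x m set_integrable_Gamma in auto)
  then show ?thesis by simp
qed

lemma V_at_top_eq_1:
  fixes m :: real
  assumes m: "m > -1"
  shows "((\<lambda>p. V m p 1) \<longlongrightarrow>
    1 / Gamma (m + 1) * (LBINT u:{0<..}. u powr m * exp (- u) / (1 + u))) at_top"
proof -
  have "((\<lambda>p. V m p 1) \<longlongrightarrow>
    1 / Gamma (m + 1) * (LBINT u:{0<..}. u powr m * exp (- u) * (1 / (1 + u)))) at_top"
  proof (rule V_tendsto_at_top_dominated[OF m])
    fix u :: real assume u: "u > 0"
    show "((\<lambda>p. (1 powr p + u) powr (1 / p - 1)) \<longlongrightarrow> 1 / (1 + u)) at_top"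
    proof -
      have "((\<lambda>p. (1 + u) powr (1 / p - 1)) \<longlongrightarrow> (1 + u) powr (0 - 1)) at_top"
        using u by (intro tendsto_intros) (auto intro: real_tendsto_divide_at_top filterlim_ident)
      then show ?thesis
        using u by (simp add: powr_minus_divide)
    qed
    fix p :: real assume p: "p \<ge> 1"
    have "(1 + u) powr (1 / p - 1) \<le> 1 powr (1 / p - 1)"
      using u p by (intro powr_mono2') auto
    then show "(1 powr p + u) powr (1 / p - 1) \<le> 1" by simp
  qed (use m set_integrable_Gamma in auto)
  then show ?thesis by simp
qed

text \<open>
  The majorant \<open>1 / u + 1\<close> comes from \<open>(x\<^sup>p + u)\<^bsup>1/p\<^esup> \<le> 1 + u\<close> and \<open>x\<^sup>p + u \<ge> u\<close>. It is singular at 0,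
  unlike the one for \<open>x \<ge> 1\<close>, and this is where \<open>m > 0\<close> enters.
\<close>

lemma V_at_top_less_1:
  fixes m x :: real
  assumes m: "m > 0" and x: "0 < x" "x < 1"
  shows "((\<lambda>p. V m p x) \<longlongrightarrow> 1 / m) at_top"
proof -
  have weight: "u powr m * exp (- u) * (1 / u) = u powr (m - 1) * exp (- u)" if "u > 0" for u :: real
    using that by (simp add: powr_diff)
  have "((\<lambda>p. V m p x) \<longlongrightarrow>
    1 / Gamma (m + 1) * (LBINT u:{0<..}. u powr m * exp (- u) * (1 / u))) at_top"
  proof (rule V_tendsto_at_top_dominated)
    fix u :: real assume u: "u > 0"
    have "((\<lambda>p. x powr p) \<longlongrightarrow> 0) at_top"
      using x by real_asymp
    then have "((\<lambda>p. (x powr p + u) powr (1 / p - 1)) \<longlongrightarrow> (0 + u) powr (0 - 1)) at_top"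
      using u by (intro tendsto_intros) (auto intro: real_tendsto_divide_at_top filterlim_ident)
    then show "((\<lambda>p. (x powr p + u) powr (1 / p - 1)) \<longlongrightarrow> 1 / u) at_top"
      using u by (simp add: powr_minus_divide)
    fix p :: real assume p: "p \<ge> 1"
    have xp: "0 < x powr p" "x powr p \<le> 1"
      using x p by (auto intro: powr_le1)
    have "(x powr p + u) powr (1 / p) \<le> (1 + u) powr (1 / p)"
      using xp u p by (intro powr_mono2) auto
    also have "\<dots> \<le> (1 + u) powr 1"
      using u p by (intro powr_mono) auto
    finally have "(x powr p + u) powr (1 / p) \<le> 1 + u"
      using u by simp
    then have "(x powr p + u) powr (1 / p) / (x powr p + u) \<le> (1 + u) / u"
      using xp u by (intro frac_le) auto
    also have "(1 + u) / u = 1 / u + 1"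
      using u by (simp add: field_simps)
    finally show "(x powr p + u) powr (1 / p - 1) \<le> 1 / u + 1"
      using xp u by (simp add: powr_diff)
  next
    have "set_integrable lborel {0<..} (\<lambda>u. u powr (m - 1) * exp (- u) + u powr m * exp (- u))"
      using m by (intro set_integral_add set_integrable_Gamma) auto
    then show "set_integrable lborel {0<..} (\<lambda>u. u powr m * exp (- u) * (1 / u + 1))"
      by (rule set_integrable_cong[THEN iffD1, rotated -1]) (auto simp: distrib_left weight[simplified])
  qed (use m x in auto)
  also have "(LBINT u:{0<..}. u powr m * exp (- u) * (1 / u))
      = (LBINT u:{0<..}. u powr (m - 1) * exp (- u))"
    by (intro set_lebesgue_integral_cong) (auto simp: weight[simplified])
  also have "\<dots> = Gamma m"
    using set_integral_Gamma[of "m - 1"] m by simp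
  also have "1 / Gamma (m + 1) * Gamma m = 1 / m"
  proof -
    have "Gamma (m + 1) = m * Gamma m"
      using m by (intro Gamma_plus1) auto
    moreover have "Gamma m \<noteq> 0"
      using Gamma_real_pos[OF m] by linarith
    ultimately show ?thesis
      by simp
  qed
  finally show ?thesis .
qed

theorem proposition2:
  fixes m x :: real
  assumes "m > -1" and "x > 0"
  shows "filterlim (\<lambda>p. V m p x) at_top (at_right 0) \<and>
    (x \<ge> 1 \<longrightarrow> strict_antimono_on {0<..} (\<lambda>p. V m p x)) \<and>
    (x > 1 \<longrightarrow> ((\<lambda>p. V m p x) \<longlongrightarrow> 0) at_top) \<and>
    (x = 1 \<longrightarrow> ((\<lambda>p. V m p 1) \<longlongrightarrow>
       1 / Gamma (m + 1) * (LBINT u:{0<..}. u powr m * exp (- u) / (1 + u))) at_top) \<and>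
    (x < 1 \<and> m > 0 \<longrightarrow> ((\<lambda>p. V m p x) \<longlongrightarrow> 1 / m) at_top)"
  using assms V_at_right_0 V_strict_antimono V_at_top_gt_1 V_at_top_eq_1 V_at_top_less_1 by simp

end
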